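(* For all integers $n,k$ with $n\ge k+2\ge 3$, $$g(n,k)=\sum_{i=0}^{n-k-2}\binom{n-k-2}{i}\frac{(2^k-1)^i}{2^{k(n-k)}}\,g(n-k,i).$$
   Context: For $n\ge2$, the complete graph $K_n$ on the vertex set $[n]=\{1,\dots,n\}$ is randomly oriented: each edge is independently given one of its two possible directions, each with probability $\frac12$; $P_n$ denotes the corresponding probability. For vertices $u\neq v$, $\{u\nrightarrow v\}$ is the event that there is no directed path from $u$ to $v$. For $s\in[n]$ and $K\subset[n]\setminus\{s\}$, let $\{K\nrightarrow s\}$ be the event that $a\nrightarrow s$ for every $a\in K$. For $n\ge3$, distinct $s,b\in[n]$, and $K\subset[n]\setminus\{s,b\}$ with $|K|=k$ (so $0\le k\le n-2$) define $g(n,k):=P_n(K\nrightarrow s,\ s\nrightarrow b)$ (the probability that both events occur), which depends only on $n$ and $k$; in particular $g(n,0)=P_n(s\nrightarrow b)$. Also set $g(2,0):=\frac12$ (the probability $P_2(s\nrightarrow b)$ in $K_2$). *)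

theory Defs
  imports "HOL-Probability.Probability"
begin

definition edges :: "'a set \<Rightarrow> 'a set set" where
  "edges V = {e. e \<subseteq> V \<and> card e = 2}"

text \<open>
  An orientation of the complete graph on \<open>V\<close> is encoded as a function \<open>h\<close> that sends every edge
  \<open>e = {u, v}\<close> to its head, i.e. \<open>u \<rightarrow> v\<close> iff \<open>h {u, v} = v\<close>. The head of each edge is chosen
  uniformly among its two endpoints, independently for different edges; off the edges \<open>h\<close> is
  \<open>undefined\<close>.
\<close>

definition random_orientation :: "'a set \<Rightarrow> ('a set \<Rightarrow> 'a) pmf" where
  "random_orientation V = Pi_pmf (edges V) undefined pmf_of_set"

definition arcs :: "'a set \<Rightarrow> ('a set \<Rightarrow> 'a) \<Rightarrow> ('a \<times> 'a) set" where
  "arcs V h = {(u, v). u \<in> V \<and> v \<in> V \<and> u \<noteq> v \<and> h {u, v} = v}"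

definition no_path :: "'a set \<Rightarrow> ('a set \<Rightarrow> 'a) \<Rightarrow> 'a \<Rightarrow> 'a \<Rightarrow> bool" where
  "no_path V h u v \<longleftrightarrow> (u, v) \<notin> (arcs V h)\<^sup>*"

definition no_path_prob :: "'a set \<Rightarrow> 'a set \<Rightarrow> 'a \<Rightarrow> 'a \<Rightarrow> real" where
  "no_path_prob V K s b =
     measure_pmf.prob (random_orientation V) {h. (\<forall>a\<in>K. no_path V h a s) \<and> no_path V h s b}"

text \<open>
  The probability only depends on the sizes of the vertex set and of \<open>K\<close>, so \<open>g\<close> is defined by
  the representatives \<open>s = 1\<close>, \<open>b = 2\<close>, \<open>K = {3..k+2}\<close>. The lemmas \<open>no_path_prob_eq_g\<close> and
  \<open>g_2_0\<close> below show that every other choice gives the same value and that the definition also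
  yields the convention \<open>g 2 0 = 1/2\<close>. Only arguments with \<open>k + 2 \<le> n\<close> are meaningful.
\<close>

definition g :: "nat \<Rightarrow> nat \<Rightarrow> real" where
  "g n k = no_path_prob {1..n} {3..k+2} 1 2"

definition transport :: "'a set \<Rightarrow> ('a \<Rightarrow> 'b) \<Rightarrow> ('a set \<Rightarrow> 'a) \<Rightarrow> ('b set \<Rightarrow> 'b)" where
  "transport V f h = (\<lambda>e. if e \<in> edges (f ` V) then f (h (inv_into V f ` e)) else undefined)"

lemma finite_edges: "finite V \<Longrightarrow> finite (edges V)"
  by (rule finite_subset[of _ "Pow V"]) (auto simp: edges_def)

lemma edges_nonempty: "e \<in> edges V \<Longrightarrow> finite e \<and> e \<noteq> {}"
  by (auto simp: edges_def intro: card_ge_0_finite)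

lemma edges_dflt:
  assumes "finite V"
  shows "finite (PiE_dflt (edges V) undefined (\<lambda>e. e))"
    and "PiE_dflt (edges V) undefined (\<lambda>e. e) \<noteq> {}"
  using assms edges_nonempty[of _ V] by (auto intro!: finite_PiE_dflt finite_edges)

lemma random_orientation_uniform:
  assumes "finite V"
  shows "random_orientation V = pmf_of_set (PiE_dflt (edges V) undefined (\<lambda>e. e))"
  unfolding random_orientation_def using assms
  by (intro Pi_pmf_of_set finite_edges) (auto dest: edges_nonempty)

lemma edges_image:
  assumes "inj_on f V" "e \<in> edges V"
  shows "f ` e \<in> edges (f ` V)"
proof -
  have "inj_on f e" using assms inj_on_subset[of f V e] by (simp add: edges_def)
  thus ?thesis using assms by (auto simp: edges_def card_image)
qed

lemma edges_inv_image:
  assumes "inj_on f V" "e \<in> edges (f ` V)"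
  shows "inv_into V f ` e \<in> edges V"
  using edges_image[OF inj_on_inv_into[of "f ` V" f V] assms(2)] assms(1)
  by (simp add: inv_into_image_cancel)

lemma bij_transport:
  assumes inj: "inj_on f V"
  shows "bij_betw (transport V f) (PiE_dflt (edges V) undefined (\<lambda>e. e))
           (PiE_dflt (edges (f ` V)) undefined (\<lambda>e. e))"
proof (rule bij_betwI[where g = "\<lambda>h e. if e \<in> edges V then inv_into V f (h (f ` e)) else undefined"])
  show "transport V f \<in> PiE_dflt (edges V) undefined (\<lambda>e. e) \<rightarrow> PiE_dflt (edges (f ` V)) undefined (\<lambda>e. e)"
  proof
    fix h assume h: "h \<in> PiE_dflt (edges V) undefined (\<lambda>e. e)"
    have "f (h (inv_into V f ` e)) \<in> e" if e: "e \<in> edges (f ` V)" for e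
    proof -
      have "h (inv_into V f ` e) \<in> inv_into V f ` e"
        using h edges_inv_image[OF inj e] by (auto simp: PiE_dflt_def)
      moreover have "f ` inv_into V f ` e = e"
        using e by (intro image_inv_into_cancel[OF refl]) (auto simp: edges_def)
      ultimately show ?thesis by blast
    qed
    thus "transport V f h \<in> PiE_dflt (edges (f ` V)) undefined (\<lambda>e. e)"
      by (auto simp: PiE_dflt_def transport_def)
  qed
  show "(\<lambda>h e. if e \<in> edges V then inv_into V f (h (f ` e)) else undefined)
      \<in> PiE_dflt (edges (f ` V)) undefined (\<lambda>e. e) \<rightarrow> PiE_dflt (edges V) undefined (\<lambda>e. e)"
  proof
    fix h assume h: "h \<in> PiE_dflt (edges (f ` V)) undefined (\<lambda>e. e)"
    have "inv_into V f (h (f ` e)) \<in> e" if e: "e \<in> edges V" for e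
    proof -
      have "h (f ` e) \<in> f ` e"
        using h edges_image[OF inj e] by (auto simp: PiE_dflt_def)
      then obtain x where "x \<in> e" "h (f ` e) = f x" by blast
      moreover have "x \<in> V" using e \<open>x \<in> e\<close> by (auto simp: edges_def)
      ultimately show ?thesis using inj by (simp add: inv_into_f_f)
    qed
    thus "(\<lambda>e. if e \<in> edges V then inv_into V f (h (f ` e)) else undefined)
            \<in> PiE_dflt (edges V) undefined (\<lambda>e. e)"
      by (auto simp: PiE_dflt_def)
  qed
next
  fix h assume h: "h \<in> PiE_dflt (edges V) undefined (\<lambda>e. e)"
  show "(\<lambda>e. if e \<in> edges V then inv_into V f (transport V f h (f ` e)) else undefined) = h"
  proof
    fix e
    show "(if e \<in> edges V then inv_into V f (transport V f h (f ` e)) else undefined) = h e"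
    proof (cases "e \<in> edges V")
      case True
      hence "e \<subseteq> V" "h e \<in> V" using h by (auto simp: edges_def PiE_dflt_def)
      thus ?thesis using True edges_image[OF inj True] inj
        by (simp add: transport_def inv_into_image_cancel)
    qed (use h in \<open>auto simp: PiE_dflt_def\<close>)
  qed
next
  fix h assume h: "h \<in> PiE_dflt (edges (f ` V)) undefined (\<lambda>e. e)"
  show "transport V f (\<lambda>e. if e \<in> edges V then inv_into V f (h (f ` e)) else undefined) = h"
  proof
    fix e
    show "transport V f (\<lambda>e. if e \<in> edges V then inv_into V f (h (f ` e)) else undefined) e = h e"
    proof (cases "e \<in> edges (f ` V)")
      case True
      hence "e \<subseteq> f ` V" "h e \<in> f ` V" using h by (auto simp: edges_def PiE_dflt_def)
      thus ?thesis using True edges_inv_image[OF inj True]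
        by (simp add: transport_def image_inv_into_cancel f_inv_into_f)
    qed (use h in \<open>auto simp: PiE_dflt_def transport_def\<close>)
  qed
qed

lemma random_orientation_transport:
  assumes "finite V" "inj_on f V"
  shows "random_orientation (f ` V) = map_pmf (transport V f) (random_orientation V)"
proof -
  have "finite (PiE_dflt (edges V) undefined (\<lambda>e. e))"
    by (rule edges_dflt(1)[OF assms(1)])
  moreover have "PiE_dflt (edges V) undefined (\<lambda>e. e) \<noteq> {}"
    by (rule edges_dflt(2)[OF assms(1)])
  ultimately show ?thesis
    using assms map_pmf_of_set_bij_betw[OF bij_transport[OF assms(2)]]
    by (simp add: random_orientation_uniform)
qed

lemma arcs_transport:
  assumes inj: "inj_on f V" and h: "h \<in> PiE_dflt (edges V) undefined (\<lambda>e. e)"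
  shows "arcs (f ` V) (transport V f h) = map_prod f f ` arcs V h"
proof -
  have eq: "(f u, f v) \<in> arcs (f ` V) (transport V f h) \<longleftrightarrow> (u, v) \<in> arcs V h"
    if uv: "u \<in> V" "v \<in> V" for u v
  proof (cases "u = v")
    case False
    have e: "{u, v} \<in> edges V" using uv False by (auto simp: edges_def)
    have "f ` {u, v} \<in> edges (f ` V)" by (rule edges_image[OF inj e])
    moreover have "inv_into V f ` f ` {u, v} = {u, v}"
      using uv inj by (intro inv_into_image_cancel) auto
    ultimately have "transport V f h {f u, f v} = f (h {u, v})"
      by (simp add: transport_def)
    moreover have "h {u, v} \<in> V" using h e uv by (auto simp: PiE_dflt_def)
    ultimately show ?thesis using uv inj False by (auto simp: arcs_def inj_on_eq_iff)
  qed (auto simp: arcs_def)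
  show ?thesis
  proof (intro equalityI subrelI)
    fix x y assume xy: "(x, y) \<in> arcs (f ` V) (transport V f h)"
    then obtain u v where "u \<in> V" "v \<in> V" "x = f u" "y = f v" by (auto simp: arcs_def)
    thus "(x, y) \<in> map_prod f f ` arcs V h" using xy eq by force
  next
    fix x y assume "(x, y) \<in> map_prod f f ` arcs V h"
    then obtain u v where "(u, v) \<in> arcs V h" "x = f u" "y = f v" by auto
    thus "(x, y) \<in> arcs (f ` V) (transport V f h)" using eq by (auto simp: arcs_def)
  qed
qed

lemma rtrancl_map_prod:
  assumes inj: "inj_on f V" and R: "R \<subseteq> V \<times> V" and uv: "u \<in> V" "v \<in> V"
  shows "(f u, f v) \<in> (map_prod f f ` R)\<^sup>* \<longleftrightarrow> (u, v) \<in> R\<^sup>*"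
proof
  assume "(u, v) \<in> R\<^sup>*"
  thus "(f u, f v) \<in> (map_prod f f ` R)\<^sup>*"
  proof induction
    case (step y z)
    have "(f y, f z) \<in> map_prod f f ` R" using step.hyps(2) by force
    thus ?case using step.IH by (rule rtrancl_into_rtrancl[rotated])
  qed simp
next
  have "\<exists>y\<in>V. b = f y \<and> (u, y) \<in> R\<^sup>*" if "(f u, b) \<in> (map_prod f f ` R)\<^sup>*" for b
    using that
  proof induction
    case base
    show ?case using uv by auto
  next
    case (step y z)
    then obtain x where x: "x \<in> V" "y = f x" "(u, x) \<in> R\<^sup>*" by auto
    from step.hyps(2) obtain p q where pq: "(p, q) \<in> R" "y = f p" "z = f q" by auto
    hence "p = x" "q \<in> V" using R x inj by (auto dest: inj_onD)
    thus ?case using x pq by (auto intro: rtrancl_into_rtrancl)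
  qed
  moreover assume "(f u, f v) \<in> (map_prod f f ` R)\<^sup>*"
  ultimately obtain y where "y \<in> V" "f v = f y" "(u, y) \<in> R\<^sup>*" by blast
  thus "(u, v) \<in> R\<^sup>*" using inj uv by (metis inj_onD)
qed

lemma no_path_transport:
  assumes "inj_on f V" "h \<in> PiE_dflt (edges V) undefined (\<lambda>e. e)" "u \<in> V" "v \<in> V"
  shows "no_path (f ` V) (transport V f h) (f u) (f v) \<longleftrightarrow> no_path V h u v"
proof -
  have "arcs V h \<subseteq> V \<times> V" by (auto simp: arcs_def)
  from rtrancl_map_prod[OF assms(1) this assms(3,4)] show ?thesis
    unfolding no_path_def arcs_transport[OF assms(1,2)] by simp
qed

lemma no_path_prob_image:
  assumes fin: "finite V" and inj: "inj_on f V" and sub: "K \<subseteq> V" "s \<in> V" "b \<in> V"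
  shows "no_path_prob (f ` V) (f ` K) (f s) (f b) = no_path_prob V K s b"
proof -
  have set: "set_pmf (random_orientation V) \<subseteq> PiE_dflt (edges V) undefined (\<lambda>e. e)"
    unfolding random_orientation_uniform[OF fin] 
    using set_pmf_of_set[OF edges_dflt(2)[OF fin] edges_dflt(1)[OF fin]] by (rule equalityD1)
  have "no_path_prob (f ` V) (f ` K) (f s) (f b) =
    measure_pmf.prob (random_orientation V)
      {h. (\<forall>a\<in>K. no_path (f ` V) (transport V f h) (f a) (f s)) \<and>
          no_path (f ` V) (transport V f h) (f s) (f b)}"
    unfolding no_path_prob_def random_orientation_transport[OF fin inj]
    by (simp add: vimage_def)
  also have "\<dots> = no_path_prob V K s b"
    unfolding no_path_prob_def
  proof (rule measure_pmf.finite_measure_eq_AE)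
    show "AE h in measure_pmf (random_orientation V).
      (h \<in> {h. (\<forall>a\<in>K. no_path (f ` V) (transport V f h) (f a) (f s)) \<and>
          no_path (f ` V) (transport V f h) (f s) (f b)}) \<longleftrightarrow>
      (h \<in> {h. (\<forall>a\<in>K. no_path V h a s) \<and> no_path V h s b})"
    proof (rule AE_pmfI)
      fix h assume "h \<in> set_pmf (random_orientation V)"
      hence h: "h \<in> PiE_dflt (edges V) undefined (\<lambda>e. e)" using set by auto
      have "no_path (f ` V) (transport V f h) (f a) (f s) \<longleftrightarrow> no_path V h a s" if "a \<in> K" for a
        using that sub by (intro no_path_transport[OF inj h]) auto
      thus "(h \<in> {h. (\<forall>a\<in>K. no_path (f ` V) (transport V f h) (f a) (f s)) \<and>
          no_path (f ` V) (transport V f h) (f s) (f b)}) \<longleftrightarrow>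
      (h \<in> {h. (\<forall>a\<in>K. no_path V h a s) \<and> no_path V h s b})"
        using no_path_transport[OF inj h sub(2,3)] by auto
    qed
  qed auto
  finally show ?thesis .
qed

lemma no_path_prob_eq_g:
  assumes fin: "finite V" and V: "s \<in> V" "b \<in> V" "s \<noteq> b" and K: "K \<subseteq> V - {s, b}"
  shows "no_path_prob V K s b = g (card V) (card K)"
proof -
  define n k where "n = card V" and "k = card K"
  define R where "R = V - {s, b} - K"
  have finK: "finite K" using fin K finite_subset by blast
  have "card {s, b} \<le> n - k"
  proof -
    have "card (K \<union> {s, b}) \<le> n" unfolding n_def using fin K V by (intro card_mono) auto
    moreover have "card (K \<union> {s, b}) = k + card {s, b}"
      unfolding k_def using finK K by (intro card_Un_disjoint) auto
    ultimately show ?thesis by linarith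
  qed
  hence nk: "k + 2 \<le> n" using V(3) by simp
  have cR: "card R = n - k - 2"
  proof -
    have "card R = card (V - {s, b}) - card K"
      unfolding R_def using finK K by (intro card_Diff_subset) auto
    also have "card (V - {s, b}) = n - 2"
      unfolding n_def using V fin by (subst card_Diff_subset) auto
    finally show ?thesis by (simp add: k_def)
  qed
  obtain p where p: "bij_betw p {3..k+2} K"
    using finite_same_card_bij[of "{3..k+2}" K] finK by (auto simp: k_def)
  obtain q where q: "bij_betw q {k+3..n} R"
    using finite_same_card_bij[of "{k+3..n}" R] fin cR nk by (auto simp: R_def)
  define f where "f = (\<lambda>i::nat. if i = 1 then s else if i = 2 then b else if i \<le> k + 2 then p i else q i)"
  have fK: "f ` {3..k+2} = K" and injK: "inj_on f {3..k+2}"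
    using p by (auto simp: f_def bij_betw_def inj_on_def)
  have fR: "f ` {k+3..n} = R" and injR: "inj_on f {k+3..n}"
    using q by (auto simp: f_def bij_betw_def inj_on_def)
  have split: "{1..n} = {1, 2} \<union> ({3..k+2} \<union> {k+3..n})" using nk by auto
  have f12: "f 1 = s" "f 2 = b" by (auto simp: f_def)
  have fV: "f ` {1..n} = V"
    unfolding split image_Un fK fR using V K by (auto simp: f12[simplified] R_def)
  have "inj_on f {1..n}"
  proof (rule eq_card_imp_inj_on)
    show "card (f ` {1..n}) = card {1..n}" unfolding fV by (simp add: n_def)
  qed simp
  hence "no_path_prob (f ` {1..n}) (f ` {3..k+2}) (f 1) (f 2) = no_path_prob {1..n} {3..k+2} 1 2"
    by (rule no_path_prob_image[OF finite_atLeastAtMost]) (use nk in auto)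
  thus ?thesis unfolding fV fK f12 by (simp add: g_def n_def k_def)
qed

lemma g_2_0: "g 2 0 = 1 / 2"
proof -
  have V: "{1..2::nat} = {1, 2}" by auto
  have e: "edges {1, 2::nat} = {{1, 2}}"
  proof (intro equalityI subsetI)
    fix e assume "e \<in> edges {1, 2::nat}"
    hence "e \<subseteq> {1, 2}" "card e = card {1, 2::nat}" by (auto simp: edges_def)
    hence "e = {1, 2}" by (intro card_subset_eq) auto
    thus "e \<in> {{1, 2}}" by blast
  qed (auto simp: edges_def)
  have np: "no_path {1, 2} h 1 2 \<longleftrightarrow> h {1, 2::nat} \<noteq> 2" for h
  proof (cases "h {1, 2} = 2")
    case True
    hence "(1, 2) \<in> arcs {1, 2} h" by (simp add: arcs_def)
    thus ?thesis using True by (auto simp: no_path_def)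
  next
    case False
    have star: "(1, y) \<in> (arcs {1, 2} h)\<^sup>* \<Longrightarrow> y = 1" for y
      by (induction rule: rtrancl_induct) (use False in \<open>auto simp: arcs_def\<close>)
    have "(1, 2) \<notin> (arcs {1, 2} h)\<^sup>*" using star[of 2] by linarith
    thus ?thesis using False by (auto simp: no_path_def)
  qed
  have int: "{1, 2} \<inter> {x::nat. x \<noteq> 2} = {1}" by auto
  have "g 2 0 = measure_pmf.prob (pmf_of_set {1, 2::nat}) {x. x \<noteq> 2}"
    unfolding g_def no_path_prob_def random_orientation_def V e
    by (simp add: np[simplified] Pi_pmf_singleton vimage_def)
  also have "\<dots> = 1 / 2"
    by (subst measure_pmf_of_set) (simp_all only: int, simp_all)
  finally show ?thesis .
qed

end

theory Submission
  imports Defs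
begin

text \<open>
  Split the vertex set as \<open>K \<union> W\<close> with \<open>s, b \<in> W\<close>, and let \<open>N \<subseteq> W\<close> be the set of vertices of \<open>W\<close>
  that receive an arc from \<open>K\<close>. The recursion comes from conditioning on \<open>N\<close>.

  Suppose that no vertex of \<open>K\<close> reaches \<open>s\<close> and that \<open>s\<close> does not reach \<open>b\<close>. Then \<open>s \<notin> N\<close>, so \<open>s\<close> sends an arc to every vertex of \<open>K \<noteq> {}\<close>; since \<open>s\<close> cannot reach
  \<open>b\<close>, this forces \<open>b \<notin> N\<close> as well. The part of a path after its last visit to \<open>K\<close> starts in \<open>N\<close>
  and stays in \<open>W\<close>. Hence \<open>K\<close> fails to reach \<open>s\<close> iff \<open>N\<close> fails to reach \<open>s\<close> inside \<open>W\<close>, whereas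
  the absence of a path from \<open>s\<close> to \<open>b\<close> seems to need, besides its absence inside \<open>W\<close>, that \<open>N\<close>
  does not reach \<open>b\<close>. The latter is automatic: the edge between \<open>s\<close> and \<open>b\<close> then points from \<open>b\<close>
  to \<open>s\<close>, so that \<open>N\<close> reaching \<open>b\<close> would make it reach \<open>s\<close>. Thus the event is the disjoint union,
  over \<open>I \<subseteq> W - {s, b}\<close>, of the events that \<open>N = I\<close> and that \<open>W\<close> with \<open>I\<close> in the place of \<open>K\<close>
  satisfies the same condition (lemma \<open>no_path_Un_iff\<close>).

  The two conditions for a given \<open>I\<close> concern disjoint sets of edges and are independent. With
  \<open>k = card K\<close> and \<open>m = card W\<close>, the set \<open>N\<close> equals \<open>I\<close> with probability
  \<open>(2 ^ k - 1) ^ card I / 2 ^ (k * m)\<close>, because each vertex of \<open>I\<close> admits every orientation of its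
  \<open>k\<close> edges to \<open>K\<close> but one, and each other vertex of \<open>W\<close> admits just one
  (lemma \<open>prob_out_neighbours_eq\<close>). Grouping the sets \<open>I\<close> by cardinality gives the binomial
  coefficients.
\<close>

section \<open>Sums over subsets\<close>

lemma sum_Pow_card:
  fixes f :: "nat \<Rightarrow> real"
  assumes "finite A"
  shows "(\<Sum>I\<in>Pow A. f (card I)) = (\<Sum>i=0..card A. real (card A choose i) * f i)"
proof -
  have "(\<Sum>I\<in>Pow A. f (card I))
      = (\<Sum>i=0..card A. \<Sum>I | I \<in> Pow A \<and> card I = i. f (card I))"
    using assms by (intro sum.group[symmetric]) (auto intro: card_mono)
  also have "\<dots> = (\<Sum>i=0..card A. real (card A choose i) * f i)"
    using n_subsets[OF assms] by (intro sum.cong) auto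
  finally show ?thesis .
qed

text \<open>
  The uniqueness half of Moebius inversion on the subset lattice. It turns the easily computed
  probabilities of \<open>N \<subseteq> J\<close> into those of \<open>N = J\<close> without alternating sums.
\<close>

lemma subset_sums_determine:
  fixes p q :: "'a set \<Rightarrow> real"
  assumes "finite J" and "\<And>L. L \<subseteq> J \<Longrightarrow> sum p (Pow L) = sum q (Pow L)"
  shows "p J = q J"
  using assms
proof (induction J rule: finite_psubset_induct)
  case (psubset J)
  have "sum p (Pow J - {J}) = sum q (Pow J - {J})"
    using psubset by (intro sum.cong) auto
  moreover have "sum p (Pow J) = sum q (Pow J)"
    using psubset.prems by blast
  ultimately show ?case
    using psubset.hyps sum.remove[of "Pow J" J p] sum.remove[of "Pow J" J q] by simp
qed

section \<open>Independence in finite product distributions\<close>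

text \<open>
  Restricting both factors to the countable supports makes the countability assumption of
  \<open>measure_pmf_prob_product\<close> disappear; the spaces of orientations need not be countable as types.
\<close>

lemma prob_pair_pmf_Times:
  "measure_pmf.prob (pair_pmf M N) (A \<times> B) = measure_pmf.prob M A * measure_pmf.prob N B"
proof -
  have "measure_pmf.prob (pair_pmf M N) (A \<times> B)
      = measure_pmf.prob (pair_pmf M N) ((A \<inter> set_pmf M) \<times> (B \<inter> set_pmf N))"
    by (intro measure_pmf.finite_measure_eq_AE) (auto intro!: AE_pmfI)
  also have "\<dots> = measure_pmf.prob M (A \<inter> set_pmf M) * measure_pmf.prob N (B \<inter> set_pmf N)"
    by (rule measure_pmf_prob_product) auto
  finally show ?thesis by (simp add: measure_Int_set_pmf)
qed

text \<open>
  Conditions on disjoint sets of coordinates are independent. The factor for \<open>A\<close> is taken in the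
  smaller product, which is where the recursive quantity lives; the factor for \<open>B\<close> remains in the
  full product, where its probability is computed.
\<close>

lemma prob_Pi_pmf_Un:
  assumes fin: "finite A" "finite B" "A \<inter> B = {}"
    and P: "\<And>h h'. (\<And>x. x \<in> A \<Longrightarrow> h x = h' x) \<Longrightarrow> P h = P h'"
    and Q: "\<And>h h'. (\<And>x. x \<in> B \<Longrightarrow> h x = h' x) \<Longrightarrow> Q h = Q h'"
  shows "measure_pmf.prob (Pi_pmf (A \<union> B) d p) {h. P h \<and> Q h} =
    measure_pmf.prob (Pi_pmf A d p) {h. P h} * measure_pmf.prob (Pi_pmf (A \<union> B) d p) {h. Q h}"
proof -
  let ?m = "\<lambda>(f, g). \<lambda>x. if x \<in> A then f x else g x"
  have Pm: "P (?m (f, g)) = P f" for f g by (rule P) auto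
  have Qm: "Q (?m (f, g)) = Q g" for f g by (rule Q) (use fin in auto)
  have split: "measure_pmf.prob (Pi_pmf (A \<union> B) d p) {h. R h \<and> Q h} =
      measure_pmf.prob (Pi_pmf A d p) {h. R h} * measure_pmf.prob (Pi_pmf B d p) {h. Q h}"
    if R: "\<And>f g. R (?m (f, g)) = R f" for R
  proof -
    have "?m -` {h. R h \<and> Q h} = {h. R h} \<times> {h. Q h}"
      using R Qm by auto
    thus ?thesis
      using prob_pair_pmf_Times by (simp add: Pi_pmf_union[OF fin])
  qed
  show ?thesis
    using split[of P, OF Pm] split[of "\<lambda>_. True"] by simp
qed

section \<open>Reducing the event to the complement of K\<close>

definition out_neighbours :: "'a set \<Rightarrow> 'a set \<Rightarrow> ('a set \<Rightarrow> 'a) \<Rightarrow> 'a set" where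
  "out_neighbours K W h = {w \<in> W. \<exists>a\<in>K. h {a, w} = w}"

lemma arcs_mono: "W \<subseteq> V \<Longrightarrow> arcs W h \<subseteq> arcs V h"
  by (auto simp: arcs_def)

text \<open>
  The right-hand side is closed under arcs: an arc leaving \<open>K\<close> ends in \<open>K\<close> or in an out-neighbour,
  and an arc leaving a reached vertex of \<open>W\<close> ends in \<open>K\<close> or prolongs a path inside \<open>W\<close>.
\<close>

lemma reachable_from_Un:
  assumes disj: "K \<inter> W = {}" and SW: "S \<subseteq> W"
  shows "(arcs (K \<union> W) h)\<^sup>* `` (K \<union> S)
    \<subseteq> K \<union> (arcs W h)\<^sup>* `` (out_neighbours K W h \<union> S)"
proof
  fix y assume "y \<in> (arcs (K \<union> W) h)\<^sup>* `` (K \<union> S)"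
  then obtain x where x: "x \<in> K \<union> S" and "(x, y) \<in> (arcs (K \<union> W) h)\<^sup>*" by auto
  from this(2) show "y \<in> K \<union> (arcs W h)\<^sup>* `` (out_neighbours K W h \<union> S)"
  proof induction
    case base
    show ?case using x by auto
  next
    case (step y z)
    have z: "z \<in> K \<union> W" "h {y, z} = z" "y \<noteq> z" "y \<in> K \<union> W"
      using step.hyps by (auto simp: arcs_def)
    show ?case
    proof (cases "z \<in> K")
      case False
      show ?thesis
      proof (cases "y \<in> K")
        case True
        hence "z \<in> out_neighbours K W h"
          using z False by (auto simp: out_neighbours_def)
        thus ?thesis by auto
      next
        case yK: False
        then obtain x' where "x' \<in> out_neighbours K W h \<union> S" "(x', y) \<in> (arcs W h)\<^sup>*"
          using step.IH by auto
        moreover have "(y, z) \<in> arcs W h"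
          using z False yK by (auto simp: arcs_def)
        ultimately show ?thesis by (meson ImageI UnI2 rtrancl_into_rtrancl)
      qed
    qed simp
  qed
qed

text \<open>
  The combinatorial core. The hypothesis on \<open>h\<close> says that it is a genuine orientation; it is what
  allows a missing arc to be replaced by the reversed one, from \<open>s\<close> to \<open>K\<close> in one direction and
  from \<open>b\<close> to \<open>s\<close> in the other.
\<close>

lemma no_path_Un_iff:
  assumes K: "K \<noteq> {}" "K \<inter> W = {}" and sb: "s \<in> W" "b \<in> W" "s \<noteq> b"
    and h: "\<And>e. e \<in> edges (K \<union> W) \<Longrightarrow> h e \<in> e"
  defines "N \<equiv> out_neighbours K W h"
  shows "(\<forall>a\<in>K. no_path (K \<union> W) h a s) \<and> no_path (K \<union> W) h s b \<longleftrightarrow>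
    N \<subseteq> W - {s, b} \<and> (\<forall>a\<in>N. no_path W h a s) \<and> no_path W h s b" (is "?L \<longleftrightarrow> ?R")
proof
  have head: "h {u, v} = u \<or> h {u, v} = v" if "u \<in> K \<union> W" "v \<in> K \<union> W" "u \<noteq> v" for u v
    using h[of "{u, v}"] that by (auto simp: edges_def)
  {
    assume L: ?L
    have lift: "(x, y) \<in> (arcs (K \<union> W) h)\<^sup>*" if "(x, y) \<in> (arcs W h)\<^sup>*" for x y
      using that rtrancl_mono[OF arcs_mono[of W "K \<union> W" h]] by auto
    have N: "\<exists>a\<in>K. (a, w) \<in> arcs (K \<union> W) h" if "w \<in> N" for w
      using that K(2) unfolding N_def by (auto simp: out_neighbours_def arcs_def)
    have NS: "no_path (K \<union> W) h w s" if "w \<in> N" for w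
      using N[OF that] L by (auto simp: no_path_def intro: converse_rtrancl_into_rtrancl)
    hence sN: "s \<notin> N" by (auto simp: no_path_def)
    \<comment> \<open>An arc from \<open>a \<in> K\<close> to \<open>b\<close> would complete the path from \<open>s\<close> through \<open>a\<close> to \<open>b\<close>.\<close>
    have "b \<notin> N"
    proof
      assume "b \<in> N"
      then obtain a where a: "a \<in> K" "(a, b) \<in> arcs (K \<union> W) h" using N by blast
      have "h {a, s} \<noteq> s" using sN sb a(1) unfolding N_def by (auto simp: out_neighbours_def)
      hence "(s, a) \<in> arcs (K \<union> W) h"
        using head[of s a] a(1) sb K(2) by (auto simp: arcs_def insert_commute)
      with a(2) have "(s, b) \<in> (arcs (K \<union> W) h)\<^sup>*" by (meson r_into_rtrancl rtrancl_into_rtrancl)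
      thus False using L by (simp add: no_path_def)
    qed
    thus ?R
      using sN NS L lift unfolding no_path_def by (auto simp: N_def out_neighbours_def)
  next
    assume R: ?R
    have "(s, b) \<notin> arcs W h" using R by (auto simp: no_path_def)
    hence bs: "(b, s) \<in> arcs W h"
      using head[of s b] sb by (auto simp: arcs_def insert_commute)
    have "s \<notin> (arcs W h)\<^sup>* `` N" using R by (auto simp: no_path_def)
    hence s: "s \<notin> K \<union> (arcs W h)\<^sup>* `` (N \<union> {})" using K sb by auto
    have "b \<notin> (arcs W h)\<^sup>* `` N"
      using \<open>s \<notin> (arcs W h)\<^sup>* `` N\<close> bs by (meson ImageE ImageI rtrancl_into_rtrancl)
    moreover have "(s, b) \<notin> (arcs W h)\<^sup>*" using R by (simp add: no_path_def)
    ultimately have b: "b \<notin> K \<union> (arcs W h)\<^sup>* `` (N \<union> {s})" using K sb by auto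
    have "s \<notin> (arcs (K \<union> W) h)\<^sup>* `` (K \<union> {})"
      using reachable_from_Un[OF K(2), of "{}" h] s unfolding N_def by blast
    moreover have "b \<notin> (arcs (K \<union> W) h)\<^sup>* `` (K \<union> {s})"
      using reachable_from_Un[OF K(2), of "{s}" h] b sb unfolding N_def by blast
    ultimately show ?L by (auto simp: no_path_def)
  }
qed

section \<open>The distribution of the set of out-neighbours\<close>

lemma set_pmf_random_orientation:
  assumes "finite V" "h \<in> set_pmf (random_orientation V)" "e \<in> edges V"
  shows "h e \<in> e"
proof -
  have "h \<in> PiE_dflt (edges V) undefined (\<lambda>e. e)"
    using assms(2) set_pmf_of_set[OF edges_dflt(2,1)[OF assms(1)]]
    unfolding random_orientation_uniform[OF assms(1)] by simp
  thus ?thesis using assms(3) by (auto simp: PiE_dflt_def)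
qed

text \<open>
  The \<open>card K * card U\<close> edges between \<open>K\<close> and \<open>U\<close> are distinct and each has its head in \<open>K\<close> with
  probability one half.
\<close>

lemma prob_no_arcs_between:
  assumes fin: "finite V" and sub: "K \<subseteq> V" "U \<subseteq> V" "K \<inter> U = {}"
  shows "measure_pmf.prob (random_orientation V) {h. \<forall>a\<in>K. \<forall>u\<in>U. h {a, u} \<noteq> u}
    = 1 / 2 ^ (card K * card U)"
proof -
  define C where "C = (\<lambda>(a, u). {a, u}) ` (K \<times> U)"
  define B where "B = (\<lambda>e. if e \<in> C then - U else UNIV)"
  have CE: "C \<subseteq> edges V" using sub by (fastforce simp: C_def edges_def card_2_iff)
  have inj: "inj_on (\<lambda>(a, u). {a, u}) (K \<times> U)"
    using sub by (auto simp: inj_on_def doubleton_eq_iff)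
  have cC: "card C = card K * card U"
    unfolding C_def by (simp add: card_image[OF inj] card_cartesian_product)
  \<comment> \<open>Writing the event as a product set requires a condition on \<open>h e\<close> in terms of \<open>e\<close> alone:
    the head of a crossing edge avoids \<open>U\<close>. This is the same only almost surely, since \<open>h e\<close>
    must be an endpoint of \<open>e\<close>.\<close>
  have "measure_pmf.prob (random_orientation V) {h. \<forall>a\<in>K. \<forall>u\<in>U. h {a, u} \<noteq> u}
      = measure_pmf.prob (random_orientation V) (Pi (edges V) B)"
  proof (rule measure_pmf.finite_measure_eq_AE, rule AE_pmfI)
    fix h assume h: "h \<in> set_pmf (random_orientation V)"
    have eq: "h {a, u} \<noteq> u \<longleftrightarrow> h {a, u} \<notin> U" if "a \<in> K" "u \<in> U" for a u
    proof -
      have "{a, u} \<in> edges V" using CE that by (auto simp: C_def)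
      hence "h {a, u} \<in> {a, u}" by (rule set_pmf_random_orientation[OF fin h])
      moreover have "a \<notin> U" using that sub by auto
      ultimately show ?thesis using that by auto
    qed
    have "h \<in> Pi (edges V) B \<longleftrightarrow> (\<forall>e\<in>C. h e \<notin> U)"
      using CE by (auto simp: B_def Pi_iff)
    also have "\<dots> \<longleftrightarrow> (\<forall>a\<in>K. \<forall>u\<in>U. h {a, u} \<noteq> u)"
      using eq by (auto simp: C_def)
    finally show "h \<in> {h. \<forall>a\<in>K. \<forall>u\<in>U. h {a, u} \<noteq> u} \<longleftrightarrow> h \<in> Pi (edges V) B" by simp
  qed auto
  also have "\<dots> = (\<Prod>e\<in>edges V. measure_pmf.prob (pmf_of_set e) (B e))"
    unfolding random_orientation_def by (rule measure_Pi_pmf_Pi[OF finite_edges[OF fin]])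
  also have "\<dots> = (\<Prod>e\<in>edges V. if e \<in> C then 1 / 2 else 1)"
  proof (rule prod.cong[OF refl])
    fix e assume e: "e \<in> edges V"
    show "measure_pmf.prob (pmf_of_set e) (B e) = (if e \<in> C then 1 / 2 else 1)"
    proof (cases "e \<in> C")
      case True
      then obtain a u where au: "a \<in> K" "u \<in> U" "e = {a, u}" by (auto simp: C_def)
      have "a \<noteq> u" "e \<inter> - U = {a}" using au sub by auto
      thus ?thesis using au True by (simp add: B_def measure_pmf_of_set)
    qed (simp add: B_def)
  qed
  also have "\<dots> = (\<Prod>e\<in>C. 1 / 2)"
    using CE finite_edges[OF fin] by (simp add: prod.If_cases Int_absorb1)
  also have "\<dots> = 1 / 2 ^ (card K * card U)"
    by (simp add: cC power_one_over)
  finally show ?thesis .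
qed

lemma prob_out_neighbours_subset:
  assumes fin: "finite K" "finite W" and disj: "K \<inter> W = {}" and J: "J \<subseteq> W"
  shows "measure_pmf.prob (random_orientation (K \<union> W)) {h. out_neighbours K W h \<subseteq> J}
    = 2 ^ (card K * card J) / 2 ^ (card K * card W)"
proof -
  have "{h. out_neighbours K W h \<subseteq> J} = {h. \<forall>a\<in>K. \<forall>u\<in>W - J. h {a, u} \<noteq> u}"
    by (auto simp: out_neighbours_def)
  moreover have "card K * card W = card K * card (W - J) + card K * card J"
    using card_Diff_subset[OF finite_subset[OF J fin(2)] J] card_mono[OF fin(2) J]
    by (metis le_add_diff_inverse2 distrib_left)
  moreover have "measure_pmf.prob (random_orientation (K \<union> W)) {h. \<forall>a\<in>K. \<forall>u\<in>W - J. h {a, u} \<noteq> u}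
      = 1 / 2 ^ (card K * card (W - J))"
    using fin disj by (intro prob_no_arcs_between) auto
  ultimately show ?thesis by (simp add: power_add)
qed

text \<open>
  Both sides have the same sums over the subsets of any \<open>L\<close>: by the preceding lemma on the left,
  and by expanding \<open>((2 ^ k - 1) + 1) ^ card L\<close> with \<open>k = card K\<close> on the right.
\<close>

lemma prob_out_neighbours_eq:
  assumes fin: "finite K" "finite W" and disj: "K \<inter> W = {}" and I: "I \<subseteq> W"
  shows "measure_pmf.prob (random_orientation (K \<union> W)) {h. out_neighbours K W h = I}
    = (2 ^ card K - 1) ^ card I / 2 ^ (card K * card W)"
proof (rule subset_sums_determine[where J = I])
  show "finite I" by (rule finite_subset[OF I fin(2)])
  fix L assume L: "L \<subseteq> I"
  have finL: "finite L" by (rule finite_subset[OF subset_trans[OF L I] fin(2)])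
  have "(\<Sum>J\<in>Pow L. measure_pmf.prob (random_orientation (K \<union> W)) {h. out_neighbours K W h = J})
      = measure_pmf.prob (random_orientation (K \<union> W)) (\<Union>J\<in>Pow L. {h. out_neighbours K W h = J})"
    using finL by (intro measure_pmf.finite_measure_finite_Union[symmetric])
      (auto simp: disjoint_family_on_def)
  also have "(\<Union>J\<in>Pow L. {h. out_neighbours K W h = J}) = {h. out_neighbours K W h \<subseteq> L}"
    by auto
  also have "measure_pmf.prob (random_orientation (K \<union> W)) \<dots>
      = 2 ^ (card K * card L) / 2 ^ (card K * card W)"
    using prob_out_neighbours_subset[OF fin disj] L I by auto
  also have "(2::real) ^ (card K * card L) = ((2 ^ card K - 1) + 1) ^ card L"
    by (simp add: power_mult)
  also have "\<dots> = (\<Sum>J\<in>Pow L. (2 ^ card K - 1) ^ card J)"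
    using prod_add[OF finL, of "\<lambda>_. 2 ^ card K - 1 :: real" "\<lambda>_. 1"] by simp
  finally show "(\<Sum>J\<in>Pow L. measure_pmf.prob (random_orientation (K \<union> W)) {h. out_neighbours K W h = J})
      = (\<Sum>J\<in>Pow L. (2 ^ card K - 1) ^ card J / 2 ^ (card K * card W))"
    by (simp add: sum_divide_distrib)
qed

section \<open>The recursion\<close>

lemma no_path_cong_edges:
  assumes "\<And>e. e \<in> edges W \<Longrightarrow> h e = h' e"
  shows "no_path W h u v = no_path W h' u v"
proof -
  have "h {x, y} = h' {x, y}" if "x \<in> W" "y \<in> W" "x \<noteq> y" for x y
    using that by (intro assms) (auto simp: edges_def)
  hence "arcs W h = arcs W h'" by (auto simp: arcs_def)
  thus ?thesis by (simp add: no_path_def)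
qed

text \<open>
  Reachability inside \<open>W\<close> depends on the edges within \<open>W\<close>, the out-neighbours of \<open>K\<close> on those
  between \<open>K\<close> and \<open>W\<close>.
\<close>

lemma prob_out_neighbours_and_no_path:
  assumes fin: "finite K" "finite W" and disj: "K \<inter> W = {}"
  shows "measure_pmf.prob (random_orientation (K \<union> W))
      {h. ((\<forall>a\<in>I. no_path W h a s) \<and> no_path W h s b) \<and> out_neighbours K W h = I}
    = no_path_prob W I s b *
      measure_pmf.prob (random_orientation (K \<union> W)) {h. out_neighbours K W h = I}"
proof -
  let ?P = "\<lambda>h. (\<forall>a\<in>I. no_path W h a s) \<and> no_path W h s b"
  let ?Q = "\<lambda>h. out_neighbours K W h = I"
  have E: "edges W \<union> (edges (K \<union> W) - edges W) = edges (K \<union> W)"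
    by (auto simp: edges_def)
  have Q: "?Q h = ?Q h'"
    if eq: "\<And>e. e \<in> edges (K \<union> W) - edges W \<Longrightarrow> h e = h' e" for h h'
  proof -
    have "h {a, w} = h' {a, w}" if "a \<in> K" "w \<in> W" for a w
    proof (rule eq)
      have "a \<noteq> w" using that disj by auto
      thus "{a, w} \<in> edges (K \<union> W) - edges W" using that disj by (auto simp: edges_def)
    qed
    hence "out_neighbours K W h = out_neighbours K W h'"
      by (auto simp: out_neighbours_def)
    thus ?thesis by simp
  qed
  have P: "?P h = ?P h'" if "\<And>e. e \<in> edges W \<Longrightarrow> h e = h' e" for h h'
    using no_path_cong_edges[of W h h', OF that] by simp
  have "finite (edges W)" "finite (edges (K \<union> W) - edges W)"
    using fin by (simp_all add: finite_edges)
  from prob_Pi_pmf_Un[where P = ?P and Q = ?Q, OF this Diff_disjoint P Q]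
  show ?thesis unfolding no_path_prob_def random_orientation_def E .
qed

lemma no_path_prob_recursion:
  assumes fin: "finite K" "finite W" and K: "K \<noteq> {}" "K \<inter> W = {}"
    and sb: "s \<in> W" "b \<in> W" "s \<noteq> b"
  shows "no_path_prob (K \<union> W) K s b = (\<Sum>I\<in>Pow (W - {s, b}).
    (2 ^ card K - 1) ^ card I / 2 ^ (card K * card W) * no_path_prob W I s b)"
proof -
  let ?M = "random_orientation (K \<union> W)"
  define E where "E I = {h. ((\<forall>a\<in>I. no_path W h a s) \<and> no_path W h s b) \<and> out_neighbours K W h = I}" for I
  have "no_path_prob (K \<union> W) K s b = measure_pmf.prob ?M (\<Union>I\<in>Pow (W - {s, b}). E I)"
    unfolding no_path_prob_def
  proof (rule measure_pmf.finite_measure_eq_AE, rule AE_pmfI)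
    fix h assume "h \<in> set_pmf ?M"
    hence "\<And>e. e \<in> edges (K \<union> W) \<Longrightarrow> h e \<in> e"
      using set_pmf_random_orientation[of "K \<union> W" h] fin by blast
    from no_path_Un_iff[OF K sb this]
    show "h \<in> {h. (\<forall>a\<in>K. no_path (K \<union> W) h a s) \<and> no_path (K \<union> W) h s b} \<longleftrightarrow>
        h \<in> (\<Union>I\<in>Pow (W - {s, b}). E I)"
      by (simp add: E_def)
  qed auto
  also have "\<dots> = (\<Sum>I\<in>Pow (W - {s, b}). measure_pmf.prob ?M (E I))"
    using fin by (intro measure_pmf.finite_measure_finite_Union)
      (auto simp: disjoint_family_on_def E_def)
  also have "\<dots> = (\<Sum>I\<in>Pow (W - {s, b}).
      (2 ^ card K - 1) ^ card I / 2 ^ (card K * card W) * no_path_prob W I s b)"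
  proof (rule sum.cong[OF refl])
    fix I assume "I \<in> Pow (W - {s, b})"
    hence "I \<subseteq> W" by auto
    from prob_out_neighbours_eq[OF fin K(2) this]
    show "measure_pmf.prob ?M (E I)
        = (2 ^ card K - 1) ^ card I / 2 ^ (card K * card W) * no_path_prob W I s b"
      unfolding E_def prob_out_neighbours_and_no_path[OF fin K(2)] by simp
  qed
  finally show ?thesis .
qed

theorem lemma4p2:
  fixes n k :: nat
  assumes "n \<ge> k + 2" and "k + 2 \<ge> 3"
  shows "g n k = (\<Sum>i=0..n - k - 2.
           real ((n - k - 2) choose i) * ((2 ^ k - 1) ^ i / 2 ^ (k * (n - k))) * g (n - k) i)"
proof -
  define K W where "K = {3..k + 2}" and "W = {1, 2} \<union> {k + 3..n}"
  have V: "{1..n} = K \<union> W" using assms by (auto simp: K_def W_def)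
  have KW: "finite K" "finite W" "K \<noteq> {}" "K \<inter> W = {}"
    using assms by (auto simp: K_def W_def)
  have W12: "(1::nat) \<in> W" "2 \<in> W" "(1::nat) \<noteq> 2" by (auto simp: W_def)
  have cK: "card K = k" by (simp add: K_def)
  have D: "W - {1, 2} = {k + 3..n}" by (auto simp: W_def)
  have cD: "card (W - {1, 2}) = n - k - 2" unfolding D by simp
  have cW: "card W = n - k"
    using card_Un_disjoint[OF KW(1,2,4)] cK by (simp flip: V)
  have "g n k = no_path_prob (K \<union> W) K 1 2"
    unfolding g_def V by (simp add: K_def)
  also have "\<dots> = (\<Sum>I\<in>Pow (W - {1, 2}).
      (2 ^ k - 1) ^ card I / 2 ^ (k * (n - k)) * no_path_prob W I 1 2)"
    using no_path_prob_recursion[OF KW W12] unfolding cK cW .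
  also have "\<dots> = (\<Sum>I\<in>Pow (W - {1, 2}).
      (2 ^ k - 1) ^ card I / 2 ^ (k * (n - k)) * g (n - k) (card I))"
    using no_path_prob_eq_g[OF KW(2) W12] unfolding cW by (intro sum.cong) auto
  also have "\<dots> = (\<Sum>i=0..n - k - 2.
      real ((n - k - 2) choose i) * ((2 ^ k - 1) ^ i / 2 ^ (k * (n - k)) * g (n - k) i))"
    using sum_Pow_card[of "W - {1, 2}" "\<lambda>i. (2 ^ k - 1) ^ i / 2 ^ (k * (n - k)) * g (n - k) i"] KW
    unfolding cD by simp
  finally show ?thesis by (simp only: mult.assoc)
qed

end
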